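(* Let $0<\alpha<1$, $L>0$, $k>0$, and let $G$ be an undirected and connected graph with $N$ nodes and adjacency matrix $A=(a_{ij})$. Consider the multi-agent system, for $x\in[0,L]$, $t\ge 0$, $i=1,\dots,N$, $$y_{i,t}(x,t)=k\,y_{i,xx}(x,t)+u_i(x,t),\qquad y_i(0,t)=y_i(L,t)=0,\qquad y_i(x,0)=y_i^0(x),$$ where each $y_i^0$ is bounded and continuous on $[0,L]$, with controller $$u_i(x,t)=-\sum_{j=1}^{N}a_{ij}\left(\int_0^L\xi_{ij}(x,t)^{2}\,\mathrm{d}x\right)^{\alpha-1}\xi_{ij}(x,t),\qquad \xi_{ij}(x,t)=y_i(x,t)-y_j(x,t).$$ Then the system achieves finite-time consensus, and the finite terminal time $t^*$ satisfies $$t^*\le\frac{\left[\int_0^L\frac{1}{2N}\sum_{i,j=1}^{N}(y_i^0(x)-y_j^0(x))^2\,\mathrm{d}x\right]^{1-\alpha}}{C_1(1-\alpha)},$$ where $C_1=\left(2\lambda_2(\mathcal{L}(B))\right)^{\alpha}$ with $B=(a_{ij}^{1/\alpha})\in\mathbb R^{N\times N}$.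
   Context: Graph: $G=\{\mathfrak V,\mathfrak E,A\}$ has vertices $v_1,\dots,v_N$ and nonnegative adjacency matrix $A=(a_{ij})$, with $a_{ij}>0$ if node $v_i$ can receive data from $v_j$ (i.e. $(v_j,v_i)\in\mathfrak E$, $v_j\in N_i$), and $a_{ij}=0$ otherwise. Undirected means $a_{ij}=a_{ji}$. An undirected graph is connected if for any pair $v_i,v_j$ there is a sequence $a_{ii_1},a_{i_1i_2},\dots,a_{i_mj}$ all of whose elements are positive. Laplacian: for a nonnegative matrix $M=(m_{ij})$ viewed as an adjacency matrix, $\mathcal L(M)=(l_{ij})$ with $l_{ij}=-m_{ij}$ for $j\neq i$ and $l_{ii}=\sum_{j\ne i}m_{ij}$. For symmetric $\mathcal L(M)$, $\lambda_2(\mathcal L(M))=\min_{x\ne0,\ \langle x,\mathbf 1\rangle=0}\frac{\langle x,\mathcal L(M)x\rangle}{\langle x,x\rangle}$, the second smallest eigenvalue, where $\mathbf 1=[1,\dots,1]^T$. Finite-time consensus (FTC): the system achieves FTC if there exists a finite time $t^*$ such that $\lim_{t\to t^*}|y_i(x,t)-y_j(x,t)|=0$ for any $x\in[0,L]$ and $i,j=1,\dots,N$. This $t^*$ is the terminal time. Subscripts $t$, $xx$ denote partial derivatives. The term $\left(\int_0^L\xi_{ij}^2\,\mathrm dx\right)^{\alpha-1}\xi_{ij}$ is read as $0$ when $\xi_{ij}(\cdot,t)\equiv0$ (in particular for $i=j$). *)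

theory Defs
  imports "HOL-Analysis.Analysis"
begin

text \<open>
  The index type \<^typ>\<open>'n::finite\<close> is the set of agents, so \<open>N = CARD('n)\<close>.  The state \<open>y i x t\<close>
  of agent \<open>i\<close> at position \<open>x\<close> and time \<open>t\<close> is relevant only for \<open>x \<in> [0,L]\<close> and \<open>t \<ge> 0\<close>.
\<close>

definition nonneg_matrix :: "real^'n^'n \<Rightarrow> bool" where
  "nonneg_matrix A \<longleftrightarrow> (\<forall>i j. 0 \<le> A $ i $ j)"

definition undirected :: "real^'n^'n \<Rightarrow> bool" where
  "undirected A \<longleftrightarrow> (\<forall>i j. A $ i $ j = A $ j $ i)"

definition connected_graph :: "real^'n^'n \<Rightarrow> bool" where
  "connected_graph A \<longleftrightarrow> (\<forall>i j. (\<lambda>p q. 0 < A $ p $ q)\<^sup>*\<^sup>* i j)"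

definition laplacian :: "real^'n^'n \<Rightarrow> real^'n^'n" where
  "laplacian M = (\<chi> i j. if j = i then (\<Sum>m\<in>UNIV - {i}. M $ i $ m) else - M $ i $ j)"

text \<open>\<^const>\<open>Least\<close> on the reals is the minimum, provided that it is attained.\<close>

definition lambda2 :: "real^'n^'n \<Rightarrow> real" where
  "lambda2 S = (LEAST r. \<exists>x. x \<noteq> 0 \<and> x \<bullet> (\<chi> i. 1) = 0 \<and> r = (x \<bullet> (S *v x)) / (x \<bullet> x))"

definition xi :: "('n \<Rightarrow> real \<Rightarrow> real \<Rightarrow> real) \<Rightarrow> 'n \<Rightarrow> 'n \<Rightarrow> real \<Rightarrow> real \<Rightarrow> real" where
  "xi y i j x t = y i x t - y j x t"

text \<open>
  A summand whose \<open>xi y i j\<close> vanishes identically on \<open>[0,L]\<close> at time \<open>t\<close> is \<open>0\<close>, as intended.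
\<close>

definition controller ::
    "real^'n^'n \<Rightarrow> real \<Rightarrow> real \<Rightarrow> ('n::finite \<Rightarrow> real \<Rightarrow> real \<Rightarrow> real) \<Rightarrow> 'n \<Rightarrow> real \<Rightarrow> real \<Rightarrow> real" where
  "controller A \<alpha> L y i x t =
     - (\<Sum>j\<in>UNIV. A $ i $ j * (integral {0..L} (\<lambda>z. (xi y i j z t)\<^sup>2)) powr (\<alpha> - 1) * xi y i j x t)"

text \<open>
  Classical solutions of \<open>y\<^sub>t = k y\<^sub>x\<^sub>x + u\<close> with homogeneous Dirichlet conditions and initial data \<open>y0\<close>.

  The initial data are merely continuous, so the differential equation is imposed for \<open>t > 0\<close>.  They
  also need not vanish at \<open>0\<close> and \<open>L\<close>; hence the boundary condition is imposed for \<open>t > 0\<close> and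
  continuity may fail at the corners \<open>(0,0)\<close> and \<open>(L,0)\<close>, near which \<open>y\<close> has to stay bounded.
  If \<open>y\<close> is continuous at the corners as well, boundedness is automatic.

  The finite set \<open>E\<close> of times at which the equation is not imposed (while \<open>y\<close> remains continuous there)
  is needed because the controller is singular when some \<open>xi y i j\<close> reaches \<open>0\<close>: its norm behaves like
  the power \<open>2\<alpha> - 1\<close> of the norm of \<open>xi y i j\<close>, so for \<open>\<alpha> \<le> 1/2\<close> a time derivative need not exist
  at that time.  Solutions that are classical at all \<open>t > 0\<close> are the case \<open>E = {}\<close>.
\<close>

definition heat_solution ::
    "real \<Rightarrow> real \<Rightarrow> ('n \<Rightarrow> real \<Rightarrow> real \<Rightarrow> real) \<Rightarrow> ('n \<Rightarrow> real \<Rightarrow> real) \<Rightarrow> ('n \<Rightarrow> real \<Rightarrow> real \<Rightarrow> real) \<Rightarrow> bool"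
  where
  "heat_solution k L u y0 y \<longleftrightarrow>
     (\<forall>i. continuous_on ({0..L} \<times> {0..} - {(0,0), (L,0)}) (\<lambda>(x,t). y i x t)) \<and>
     (\<forall>i. \<forall>T. bounded ((\<lambda>(x,t). y i x t) ` ({0..L} \<times> {0..T}))) \<and>
     (\<forall>i. \<forall>x\<in>{0..L}. y i x 0 = y0 i x) \<and>
     (\<forall>i. \<forall>t>0. y i 0 t = 0 \<and> y i L t = 0) \<and>
     (\<exists>E yt yx yxx. finite E \<and>
        (\<forall>i. continuous_on ({0..L} \<times> ({0<..} - E)) (\<lambda>(x,t). yt i x t) \<and>
             continuous_on ({0..L} \<times> ({0<..} - E)) (\<lambda>(x,t). yx i x t) \<and>
             continuous_on ({0..L} \<times> ({0<..} - E)) (\<lambda>(x,t). yxx i x t)) \<and>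
        (\<forall>i. \<forall>x\<in>{0..L}. \<forall>t\<in>{0<..} - E.
             ((\<lambda>s. y i x s) has_real_derivative yt i x t) (at t) \<and>
             ((\<lambda>z. y i z t) has_real_derivative yx i x t) (at x within {0..L}) \<and>
             ((\<lambda>z. yx i z t) has_real_derivative yxx i x t) (at x within {0..L}) \<and>
             yt i x t = k * yxx i x t + u i x t))"

definition terminal_time :: "real \<Rightarrow> ('n \<Rightarrow> real \<Rightarrow> real \<Rightarrow> real) \<Rightarrow> real \<Rightarrow> bool" where
  "terminal_time L y ts \<longleftrightarrow> 0 \<le> ts \<and>
     (\<forall>x\<in>{0..L}. \<forall>i j. ((\<lambda>t. \<bar>y i x t - y j x t\<bar>) \<longlongrightarrow> 0) (at ts within {0..}))"

definition achieves_FTC :: "real \<Rightarrow> ('n \<Rightarrow> real \<Rightarrow> real \<Rightarrow> real) \<Rightarrow> bool" where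
  "achieves_FTC L y \<longleftrightarrow> (\<exists>ts. terminal_time L y ts)"

end

theory Submission
  imports Defs
begin

text \<open>
  Put \<open>w i j t = \<integral> (y i x t - y j x t)\<^sup>2 dx\<close> and \<open>V = 1/(2N) \<Sum>\<^sub>i\<^sub>j w i j\<close>.  By the Dirichlet conditions
  the diffusion term only decreases \<open>V\<close>, and by symmetry of \<open>A\<close> the controller contributes
  \<open>- \<Sum>\<^sub>i\<^sub>j a\<^sub>i\<^sub>j (w i j)\<^sup>\<alpha> = - \<Sum>\<^sub>i\<^sub>j (b\<^sub>i\<^sub>j w i j)\<^sup>\<alpha>\<close>.  Subadditivity of the power \<open>\<alpha> < 1\<close> and the variational
  characterisation of \<open>\<lambda>\<^sub>2\<close> bound this by \<open>- (\<Sum>\<^sub>i\<^sub>j b\<^sub>i\<^sub>j w i j)\<^sup>\<alpha> \<le> - (2 \<lambda>\<^sub>2 V)\<^sup>\<alpha> = - C\<^sub>1 V\<^sup>\<alpha>\<close>.  Hence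
  \<open>V\<^bsup>1 - \<alpha>\<^esup> + C\<^sub>1 (1 - \<alpha>) t\<close> is nonincreasing while \<open>V > 0\<close>, so \<open>V\<close> vanishes from the claimed time on,
  which is therefore itself a terminal time.
\<close>

section \<open>Subadditivity of powers with exponent in the unit interval\<close>

text \<open>The fractions \<open>a / s\<close> and \<open>b / s\<close> of \<open>s = a + b\<close>
  lie between 0 and 1, where raising to the power \<open>p\<close> does not decrease a number. They
  add up to 1, and scaling by \<open>s powr p\<close> removes the denominators.\<close>

lemma powr_add_le:
  fixes a b p :: real
  assumes "0 \<le> a" "0 \<le> b" "0 \<le> p" "p \<le> 1"
  shows "(a + b) powr p \<le> a powr p + b powr p"
proof (cases "a + b = 0")
  case True
  then show ?thesis using assms by simp
next
  case False
  define s where "s = a + b"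
  have s: "0 < s" using False assms by (simp add: s_def)
  have *: "c / s \<le> (c / s) powr p" if "0 \<le> c" "c \<le> s" for c
  proof (cases "c = 0")
    case False
    have "(c / s) powr 1 \<le> (c / s) powr p"
      by (rule powr_mono') (use that s assms in auto)
    then show ?thesis using that s by simp
  qed (use s in auto)
  have "1 = a / s + b / s" using s by (simp add: s_def flip: add_divide_distrib)
  also have "\<dots> \<le> (a / s) powr p + (b / s) powr p"
    using *[of a] *[of b] assms by (simp add: s_def add_mono)
  finally have "s powr p * 1 \<le> s powr p * ((a / s) powr p + (b / s) powr p)"
    by (intro mult_left_mono) auto
  also have "\<dots> = a powr p + b powr p"
    using s assms by (simp add: powr_divide distrib_left)
  finally show ?thesis by (simp add: s_def)
qed

lemma sum_powr_le:
  fixes z :: "'a \<Rightarrow> real"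
  assumes "\<And>i. i \<in> I \<Longrightarrow> 0 \<le> z i" "0 \<le> p" "p \<le> 1"
  shows "(\<Sum>i\<in>I. z i) powr p \<le> (\<Sum>i\<in>I. z i powr p)"
  using assms(1)
proof (induction I rule: infinite_finite_induct)
  case (insert i I)
  have "(z i + sum z I) powr p \<le> z i powr p + sum z I powr p"
    using insert.prems assms(2,3) by (intro powr_add_le sum_nonneg) auto
  then show ?case using insert by fastforce
qed auto

section \<open>Differential inequalities and extinction in finite time\<close>

text \<open>The fundamental theorem of calculus for the gauge integral tolerates finitely many
  exceptional points of a continuous function. Here they stand for the times at which the equation
  is not imposed.\<close>

lemma nonincreasing_off_finite:
  fixes f :: "real \<Rightarrow> real"
  assumes "finite S" "a \<le> b" "continuous_on {a..b} f"
    and "\<And>x. x \<in> {a<..<b} - S \<Longrightarrow> (f has_real_derivative f' x) (at x)"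
    and "\<And>x. x \<in> {a<..<b} - S \<Longrightarrow> f' x \<le> 0"
  shows "f b \<le> f a"
proof -
  define g where "g x = (if x \<in> {a<..<b} - S then f' x else 0)" for x
  have "(g has_integral (f b - f a)) {a..b}"
    by (rule fundamental_theorem_of_calculus_interior_strong[OF assms(1,2) _ assms(3)])
      (use assms(4) in \<open>auto simp: g_def simp flip: has_real_derivative_iff_has_vector_derivative\<close>)
  moreover have "((\<lambda>_. 0) has_integral 0) {a..b}" by simp
  ultimately have "f b - f a \<le> 0"
    by (rule has_integral_le) (use assms(5) in \<open>auto simp: g_def\<close>)
  then show ?thesis by simp
qed

lemma finite_time_extinction:
  fixes V :: "real \<Rightarrow> real"
  assumes "finite S" and cont: "\<And>T. continuous_on {0..T} V"
    and nonneg: "\<And>t. 0 \<le> t \<Longrightarrow> 0 \<le> V t"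
    and deriv: "\<And>t. t \<in> {0<..} - S \<Longrightarrow> (V has_real_derivative V' t) (at t)"
    and decay: "\<And>t. t \<in> {0<..} - S \<Longrightarrow> V' t \<le> - c * V t powr p"
    and c: "0 \<le> c" and p: "p < 1"
    and t: "0 \<le> t" "V 0 powr (1 - p) \<le> c * (1 - p) * t"
  shows "V t = 0"
proof (rule ccontr)
  assume "V t \<noteq> 0"
  then have Vt: "0 < V t" using nonneg[OF t(1)] by simp
  have V'_le: "V' s \<le> 0" if "s \<in> {0<..} - S" for s
    using decay[OF that] c by (simp add: order_trans)
  \<comment> \<open>Since \<open>V\<close> is nonincreasing, a positive value at \<open>t\<close>
    forces positive values before \<open>t\<close>, so the power \<open>1 - p\<close> of
    \<open>V\<close> can be differentiated all the way.\<close>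
  have pos: "0 < V s" if "s \<in> {0..t}" for s
  proof -
    have "V t \<le> V s"
      by (rule nonincreasing_off_finite[OF \<open>finite S\<close>, where f' = V'])
        (use that V'_le deriv continuous_on_subset[OF cont[of t]] in auto)
    then show ?thesis using Vt by simp
  qed
  define g where "g s = V s powr (1 - p) + c * (1 - p) * s" for s
  define g' where "g' s = (1 - p) * V s powr (- p) * V' s + c * (1 - p)" for s
  have "g t \<le> g 0"
  proof (rule nonincreasing_off_finite[OF \<open>finite S\<close> t(1), where f' = g'])
    show "continuous_on {0..t} g"
      unfolding g_def using pos by (intro continuous_intros cont) force
    fix s assume s: "s \<in> {0<..<t} - S"
    then have Vs: "0 < V s" and s': "s \<in> {0<..} - S" using pos by auto
    show "(g has_real_derivative g' s) (at s)"
      unfolding g_def g'_def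
      by (rule derivative_eq_intros deriv[OF s'] refl Vs)+
        (use Vs in \<open>simp add: powr_diff powr_minus field_simps\<close>)
    \<comment> \<open>The factor \<open>V s powr (- p)\<close> from the chain rule cancels the power
      in the decay estimate and leaves the constant rate \<open>c\<close>.\<close>
    have "V s powr (- p) * V' s \<le> V s powr (- p) * (- c * V s powr p)"
      by (rule mult_left_mono[OF decay[OF s']]) simp
    also have "\<dots> = - c" using Vs by (simp add: powr_minus field_simps)
    finally have "(1 - p) * (V s powr (- p) * V' s) \<le> (1 - p) * (- c)"
      using p by (intro mult_left_mono) auto
    then show "g' s \<le> 0" by (simp add: g'_def algebra_simps)
  qed
  moreover have "0 < V t powr (1 - p)" using Vt by simp
  ultimately show False using t(2) by (simp add: g_def)
qed

section \<open>Identities for sums over ordered pairs of agents\<close>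

text \<open>Averaging the sum with its image under exchange of \<open>i\<close> and \<open>j\<close>
  turns \<open>p i * (p i - p j)\<close> into half a square.\<close>

lemma sum_symmetric_weights:
  fixes g :: "'n::finite \<Rightarrow> 'n \<Rightarrow> real"
  assumes "\<And>i j. g i j = g j i"
  shows "(\<Sum>i\<in>UNIV. p i * (\<Sum>j\<in>UNIV. g i j * (p i - p j)))
    = (\<Sum>i\<in>UNIV. \<Sum>j\<in>UNIV. g i j * (p i - p j)\<^sup>2) / 2"
proof -
  have "(\<Sum>i\<in>UNIV. \<Sum>j\<in>UNIV. g i j * (p i * (p i - p j)))
    = (\<Sum>j\<in>UNIV. \<Sum>i\<in>UNIV. g i j * (p i * (p i - p j)))"
    by (rule sum.swap)
  also have "\<dots> = (\<Sum>i\<in>UNIV. \<Sum>j\<in>UNIV. g i j * (p j * (p j - p i)))"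
    by (subst assms) simp
  finally have "2 * (\<Sum>i\<in>UNIV. \<Sum>j\<in>UNIV. g i j * (p i * (p i - p j)))
    = (\<Sum>i\<in>UNIV. \<Sum>j\<in>UNIV. g i j * (p i * (p i - p j)))
      + (\<Sum>i\<in>UNIV. \<Sum>j\<in>UNIV. g i j * (p j * (p j - p i)))" by simp
  also have "\<dots> = (\<Sum>i\<in>UNIV. \<Sum>j\<in>UNIV. g i j * (p i - p j)\<^sup>2)"
    by (simp add: sum.distrib[symmetric] algebra_simps power2_eq_square)
  finally show ?thesis by (simp add: sum_distrib_left mult_ac)
qed

text \<open>Exchanging \<open>i\<close> and \<open>j\<close> reverses the sign. For the controller
  this means that the inputs of all agents add up to zero.\<close>

lemma sum_symmetric_weights_eq_0:
  fixes g :: "'n::finite \<Rightarrow> 'n \<Rightarrow> real"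
  assumes "\<And>i j. g i j = g j i"
  shows "(\<Sum>i\<in>UNIV. \<Sum>j\<in>UNIV. g i j * (p i - p j)) = 0"
proof -
  have "(\<Sum>i\<in>UNIV. \<Sum>j\<in>UNIV. g i j * (p i - p j))
    = (\<Sum>j\<in>UNIV. \<Sum>i\<in>UNIV. g j i * (p i - p j))"
    by (subst sum.swap, subst assms) simp
  also have "\<dots> = - (\<Sum>i\<in>UNIV. \<Sum>j\<in>UNIV. g i j * (p i - p j))"
    by (simp add: sum_negf[symmetric] algebra_simps)
  finally show ?thesis by simp
qed

text \<open>Polarised variance identity. It is applied when \<open>u\<close> has sum zero, so that
  only the product of \<open>p\<close> and \<open>u\<close> survives.\<close>

lemma sum_pairs_mult_diff:
  fixes p u :: "'n::finite \<Rightarrow> real"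
  shows "(\<Sum>i\<in>UNIV. \<Sum>j\<in>UNIV. (p i - p j) * (u i - u j))
    = 2 * real CARD('n) * (\<Sum>i\<in>UNIV. p i * u i) - 2 * (\<Sum>i\<in>UNIV. p i) * (\<Sum>i\<in>UNIV. u i)"
proof -
  have "(\<Sum>i\<in>UNIV. \<Sum>j\<in>UNIV. (p i - p j) * (u i - u j))
    = (\<Sum>i\<in>UNIV. \<Sum>j\<in>(UNIV :: 'n set). p i * u i) + (\<Sum>i\<in>(UNIV :: 'n set). \<Sum>j\<in>UNIV. p j * u j)
      - (\<Sum>i\<in>UNIV. \<Sum>j\<in>UNIV. p i * u j) - (\<Sum>i\<in>UNIV. \<Sum>j\<in>UNIV. p j * u i)"
    by (simp add: sum.distrib[symmetric] sum_subtractf[symmetric] algebra_simps del: sum_constant)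
  also have "(\<Sum>i\<in>UNIV. \<Sum>j\<in>UNIV. p j * u i) = (\<Sum>i\<in>UNIV. \<Sum>j\<in>UNIV. p i * u j)"
    by (rule sum.swap)
  also have "(\<Sum>i\<in>UNIV. \<Sum>j\<in>UNIV. p i * u j) = (\<Sum>i\<in>UNIV. p i) * (\<Sum>i\<in>UNIV. u i)"
    by (simp add: sum_product)
  also have "(\<Sum>i\<in>UNIV. \<Sum>j\<in>(UNIV :: 'n set). p i * u i) = real CARD('n) * (\<Sum>i\<in>UNIV. p i * u i)"
    by (simp flip: sum_distrib_left)
  finally show ?thesis by (simp add: algebra_simps)
qed

section \<open>The graph Laplacian and its second eigenvalue\<close>

text \<open>Each row of the Laplacian acts as a weighted sum of differences, in which a self-loop
  contributes zero. Symmetrisation then produces the squares.\<close>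

lemma laplacian_quadratic_form:
  fixes M :: "real^'n::finite^'n"
  assumes "undirected M"
  shows "v \<bullet> (laplacian M *v v)
    = (\<Sum>i\<in>UNIV. \<Sum>j\<in>UNIV. M $ i $ j * (v $ i - v $ j)\<^sup>2) / 2"
proof -
  have "(laplacian M *v v) $ i = (\<Sum>j\<in>UNIV. M $ i $ j * (v $ i - v $ j))" for i
  proof -
    have "(laplacian M *v v) $ i
      = (\<Sum>m\<in>UNIV - {i}. M $ i $ m) * v $ i + (\<Sum>j\<in>UNIV - {i}. - (M $ i $ j) * v $ j)"
      by (simp add: matrix_vector_mult_def laplacian_def sum.remove[of UNIV i])
    also have "\<dots> = (\<Sum>j\<in>UNIV - {i}. M $ i $ j * (v $ i - v $ j))"
      by (simp add: sum_distrib_left sum.distrib[symmetric] algebra_simps sum_subtractf)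
    also have "\<dots> = (\<Sum>j\<in>UNIV. M $ i $ j * (v $ i - v $ j))"
      by (simp add: sum.remove[of UNIV i])
    finally show ?thesis .
  qed
  then show ?thesis
    using sum_symmetric_weights[of "\<lambda>i j. M $ i $ j" "\<lambda>i. v $ i"] assms
    by (simp add: inner_vec_def undirected_def)
qed

lemma inner_vec_one: "x \<bullet> (\<chi> i. 1) = (\<Sum>i\<in>UNIV. x $ i)" for x :: "real^'n::finite"
  by (simp add: inner_vec_def)

text \<open>The quotient is invariant under scaling, so it suffices to minimise the continuous
  quadratic form over the unit vectors orthogonal to the ones vector, which form a compact
  set.\<close>

lemma exists_Rayleigh_minimum:
  fixes S :: "real^'n::finite^'n"
  assumes "2 \<le> CARD('n)"
  obtains x where "x \<noteq> 0" "x \<bullet> (\<chi> i. 1) = 0"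
    "\<And>z. z \<noteq> 0 \<Longrightarrow> z \<bullet> (\<chi> i. 1) = 0 \<Longrightarrow>
      (x \<bullet> (S *v x)) / (x \<bullet> x) \<le> (z \<bullet> (S *v z)) / (z \<bullet> z)"
proof -
  let ?K = "sphere 0 1 \<inter> {x::real^'n. x \<bullet> (\<chi> i. 1) = 0}"
  have normalize: "z /\<^sub>R norm z \<in> ?K" if "z \<noteq> 0" "z \<bullet> (\<chi> i. 1) = 0" for z :: "real^'n"
    using that by (simp add: dist_norm)
  have "compact ?K"
    by (intro compact_Int_closed compact_sphere closed_Collect_eq continuous_intros)
  moreover have "?K \<noteq> {}"
  proof -
    have "(UNIV :: 'n set) \<noteq> {i}" for i
    proof
      assume "(UNIV :: 'n set) = {i}"
      then have "CARD('n) = card {i}" by simp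
      then show False using assms by simp
    qed
    then obtain i j :: 'n where ij: "i \<noteq> j" by blast
    \<comment> \<open>The difference of two unit vectors is orthogonal to the ones vector. For a
      single agent the set \<open>?K\<close> would be empty.\<close>
    define z :: "real^'n" where "z = axis i 1 - axis j 1"
    have "z $ i = 1" using ij by (simp add: z_def axis_def)
    then have "z \<noteq> 0" by auto
    moreover have "z \<bullet> (\<chi> i. 1) = 0" by (simp add: z_def inner_diff_left inner_axis')
    ultimately show ?thesis using normalize[of z] by (metis empty_iff)
  qed
  moreover have "continuous_on ?K (\<lambda>x. x \<bullet> (S *v x))"
    by (intro continuous_on_inner continuous_on_id matrix_vector_mult_linear_continuous_on)
  ultimately have "\<exists>x\<in>?K. \<forall>z\<in>?K. x \<bullet> (S *v x) \<le> z \<bullet> (S *v z)"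
    by (rule continuous_attains_inf)
  then obtain x where x: "x \<in> ?K" and min: "\<And>z. z \<in> ?K \<Longrightarrow> x \<bullet> (S *v x) \<le> z \<bullet> (S *v z)"
    by (elim bexE) (rule that, auto simp only:)
  from x have xx: "x \<bullet> x = 1" by (simp add: dot_square_norm)
  show thesis
  proof
    show "x \<noteq> 0" "x \<bullet> (\<chi> i. 1) = 0" using x by auto
    fix z :: "real^'n" assume z: "z \<noteq> 0" "z \<bullet> (\<chi> i. 1) = 0"
    have "x \<bullet> (S *v x) \<le> (z /\<^sub>R norm z) \<bullet> (S *v (z /\<^sub>R norm z))"
      by (rule min[OF normalize[OF z]])
    also have "\<dots> = (z \<bullet> (S *v z)) / (z \<bullet> z)"
      by (simp add: matrix_vector_mult_scaleR dot_square_norm power2_eq_square field_simps)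
    finally show "(x \<bullet> (S *v x)) / (x \<bullet> x) \<le> (z \<bullet> (S *v z)) / (z \<bullet> z)" by (simp add: xx)
  qed
qed

text \<open>The existence of a minimiser gives \<open>LEAST\<close> its intended meaning. The
  inequality is stated without division so that it also covers \<open>z = 0\<close>.\<close>

lemma lambda2_attained:
  fixes S :: "real^'n::finite^'n"
  assumes "2 \<le> CARD('n)"
  obtains x where "x \<noteq> 0" "x \<bullet> (\<chi> i. 1) = 0" "lambda2 S = (x \<bullet> (S *v x)) / (x \<bullet> x)"
    "\<And>z. z \<bullet> (\<chi> i. 1) = 0 \<Longrightarrow> lambda2 S * (z \<bullet> z) \<le> z \<bullet> (S *v z)"
proof -
  obtain x where x: "x \<noteq> 0" "x \<bullet> (\<chi> i. 1) = 0"
    and min: "\<And>z. z \<noteq> 0 \<Longrightarrow> z \<bullet> (\<chi> i. 1) = 0 \<Longrightarrow>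
      (x \<bullet> (S *v x)) / (x \<bullet> x) \<le> (z \<bullet> (S *v z)) / (z \<bullet> z)"
    using exists_Rayleigh_minimum[OF assms] by metis
  have l: "lambda2 S = (x \<bullet> (S *v x)) / (x \<bullet> x)"
    unfolding lambda2_def by (rule Least_equality) (use x min in blast)+
  show thesis
  proof (rule that[OF x l])
    fix z :: "real^'n" assume z: "z \<bullet> (\<chi> i. 1) = 0"
    show "lambda2 S * (z \<bullet> z) \<le> z \<bullet> (S *v z)"
    proof (cases "z = 0")
      case False
      then show ?thesis using min[OF False z] l by (simp add: pos_le_divide_eq)
    qed simp
  qed
qed

text \<open>If the form vanished at the minimiser, so would each of its nonnegative terms. The
  minimiser would then be constant along edges, hence constant by connectivity, and zero by
  orthogonality to the ones vector.\<close>

lemma lambda2_laplacian_pos: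
  fixes M :: "real^'n::finite^'n"
  assumes "2 \<le> CARD('n)" "nonneg_matrix M" "undirected M" "connected_graph M"
  shows "0 < lambda2 (laplacian M)"
proof -
  obtain x where x: "x \<noteq> 0" "x \<bullet> (\<chi> i. 1) = 0"
    and l: "lambda2 (laplacian M) = (x \<bullet> (laplacian M *v x)) / (x \<bullet> x)"
    using lambda2_attained[OF assms(1)] by metis
  have terms: "0 \<le> M $ i $ j * (x $ i - x $ j)\<^sup>2" for i j
    using assms(2) by (simp add: nonneg_matrix_def)
  have nonneg: "0 \<le> x \<bullet> (laplacian M *v x)"
    unfolding laplacian_quadratic_form[OF assms(3)] by (simp add: sum_nonneg terms)
  have "x \<bullet> (laplacian M *v x) \<noteq> 0"
  proof
    assume "x \<bullet> (laplacian M *v x) = 0"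
    then have "M $ i $ j * (x $ i - x $ j)\<^sup>2 = 0" for i j
      unfolding laplacian_quadratic_form[OF assms(3)]
      by (simp add: sum_nonneg_eq_0_iff sum_nonneg terms)
    then have edge: "x $ i = x $ j" if "0 < M $ i $ j" for i j
      using that by (metis eq_iff_diff_eq_0 less_irrefl mult_eq_0_iff power_eq_0_iff)
    have eq: "x $ i = x $ j" for i j
    proof -
      have "(\<lambda>p q. 0 < M $ p $ q)\<^sup>*\<^sup>* i j" using assms(4) by (simp add: connected_graph_def)
      then show ?thesis by induction (use edge in auto)
    qed
    have "x $ i = 0" for i
    proof -
      have "x \<bullet> (\<chi> i. 1) = (\<Sum>j\<in>(UNIV :: 'n set). x $ i)"
        unfolding inner_vec_one by (intro sum.cong refl eq)
      then show ?thesis using x(2) by simp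
    qed
    then show False using x(1) by (simp add: vec_eq_iff)
  qed
  then show ?thesis using x(1) nonneg by (simp add: l)
qed

text \<open>Subtracting the mean \<open>m\<close> preserves all differences and makes the vector
  orthogonal to the ones vector. The pair sum is then \<open>2 * real CARD('n)\<close> times its
  squared norm.\<close>

lemma lambda2_laplacian_le:
  fixes M :: "real^'n::finite^'n"
  assumes "2 \<le> CARD('n)" "undirected M"
  shows "2 * lambda2 (laplacian M) * (1 / (2 * real CARD('n)) * (\<Sum>i\<in>UNIV. \<Sum>j\<in>UNIV. (p i - p j)\<^sup>2))
    \<le> (\<Sum>i\<in>UNIV. \<Sum>j\<in>UNIV. M $ i $ j * (p i - p j)\<^sup>2)"
proof -
  define m where "m = (\<Sum>i\<in>UNIV. p i) / real CARD('n)"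
  define e :: "real^'n" where "e = (\<chi> i. p i - m)"
  have sum_e: "(\<Sum>i\<in>UNIV. e $ i) = 0" by (simp add: e_def sum_subtractf m_def)
  have "lambda2 (laplacian M) * (e \<bullet> e) \<le> e \<bullet> (laplacian M *v e)"
    using lambda2_attained[OF assms(1)] sum_e by (metis inner_vec_one)
  moreover have "e \<bullet> (laplacian M *v e) = (\<Sum>i\<in>UNIV. \<Sum>j\<in>UNIV. M $ i $ j * (p i - p j)\<^sup>2) / 2"
    unfolding laplacian_quadratic_form[OF assms(2)] by (simp add: e_def)
  moreover have "(\<Sum>i\<in>UNIV. \<Sum>j\<in>UNIV. (p i - p j)\<^sup>2) = 2 * real CARD('n) * (e \<bullet> e)"
    using sum_pairs_mult_diff[of "\<lambda>i. e $ i" "\<lambda>i. e $ i"] sum_e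
    by (simp add: e_def inner_vec_def power2_eq_square)
  ultimately show ?thesis by simp
qed

section \<open>Integrals over space: dependence on time and integration by parts\<close>

text \<open>
  Continuity of \<open>f x\<close> is assumed on the open interval only, since solutions may be discontinuous at
  the corners \<open>(0,0)\<close> and \<open>(L,0)\<close>.
\<close>

lemma continuous_on_integral_of_bounded:
  fixes f :: "real \<Rightarrow> real \<Rightarrow> real"
  assumes cont: "\<And>x. x \<in> {a<..<b} \<Longrightarrow> continuous_on T (f x)"
    and int: "\<And>t. t \<in> T \<Longrightarrow> (\<lambda>x. f x t) integrable_on {a..b}"
    and bound: "\<And>x t. x \<in> {a..b} \<Longrightarrow> t \<in> T \<Longrightarrow> \<bar>f x t\<bar> \<le> C"
  shows "continuous_on T (\<lambda>t. integral {a..b} (\<lambda>x. f x t))"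
  unfolding continuous_on_sequentially
proof (intro allI ballI impI)
  fix s :: "nat \<Rightarrow> real" and t
  assume t: "t \<in> T" and s: "(\<forall>n. s n \<in> T) \<and> s \<longlonglongrightarrow> t"
  \<comment> \<open>Dropping the two endpoints does not change the integral and leaves only points
    at which \<open>f x\<close> is continuous; the constant \<open>C\<close> dominates.\<close>
  have "(\<lambda>n. integral {a<..<b} (\<lambda>x. f x (s n))) \<longlonglongrightarrow> integral {a<..<b} (\<lambda>x. f x t)"
  proof (rule dominated_convergence)
    show "(\<lambda>x. f x (s n)) integrable_on {a<..<b}" for n
      using int s by (simp add: integrable_on_open_interval_real)
    show "(\<lambda>_. C) integrable_on {a<..<b}"
      unfolding integrable_on_open_interval_real by (rule integrable_const_ivl)
    show "norm (f x (s n)) \<le> C" if "x \<in> {a<..<b}" for n x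
      using bound that s by auto
    show "(\<lambda>n. f x (s n)) \<longlonglongrightarrow> f x t" if "x \<in> {a<..<b}" for x
      using cont[OF that] s t unfolding continuous_on_sequentially o_def by blast
  qed
  then show "((\<lambda>t. integral {a..b} (\<lambda>x. f x t)) \<circ> s) \<longlonglongrightarrow> integral {a..b} (\<lambda>x. f x t)"
    by (simp add: integral_open_interval_real o_def)
qed

lemma continuous_on_slice:
  assumes "continuous_on S (\<lambda>(x, t). f x t)" "\<And>x. x \<in> X \<Longrightarrow> (x, t) \<in> S"
  shows "continuous_on X (\<lambda>x. f x t)"
proof -
  have "continuous_on X (\<lambda>x. (x, t))" by (intro continuous_intros)
  from continuous_on_compose2[OF assms(1) this] show ?thesis using assms(2) by auto
qed

lemma has_real_derivative_integral_square:
  fixes f f' :: "real \<Rightarrow> real \<Rightarrow> real"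
  assumes "open U" "t \<in> U"
    and deriv: "\<And>x s. x \<in> {a..b} \<Longrightarrow> s \<in> U \<Longrightarrow> (f x has_real_derivative f' x s) (at s)"
    and cont: "continuous_on ({a..b} \<times> U) (\<lambda>(x, s). f x s)"
      "continuous_on ({a..b} \<times> U) (\<lambda>(x, s). f' x s)"
  shows "((\<lambda>s. integral {a..b} (\<lambda>x. (f x s)\<^sup>2)) has_real_derivative
    integral {a..b} (\<lambda>x. 2 * (f x t * f' x t))) (at t)"
proof -
  obtain e where e: "0 < e" "ball t e \<subseteq> U" using assms(1,2) openE by blast
  \<comment> \<open>The Leibniz rule takes the parameter as first variable, whereas here space comes
    before time.\<close>
  have "prod.swap ` (ball t e \<times> {a..b}) \<subseteq> {a..b} \<times> U" using e(2) by auto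
  from continuous_on_compose2[OF cont(1) continuous_on_swap this]
    continuous_on_compose2[OF cont(2) continuous_on_swap this]
  have "continuous_on (ball t e \<times> {a..b}) (\<lambda>p. f (snd p) (fst p))"
    "continuous_on (ball t e \<times> {a..b}) (\<lambda>p. f' (snd p) (fst p))"
    by (simp_all add: case_prod_unfold)
  then have cont': "continuous_on (ball t e \<times> {a..b}) (\<lambda>(s, x). 2 * (f x s * f' x s))"
    unfolding case_prod_unfold by (intro continuous_intros)
  have "((\<lambda>s. integral (cbox a b) (\<lambda>x. (f x s)\<^sup>2)) has_real_derivative
    integral (cbox a b) (\<lambda>x. 2 * (f x t * f' x t))) (at t within ball t e)"
  proof (rule leibniz_rule_field_derivative)
    fix s x assume s: "s \<in> ball t e" and x: "x \<in> cbox a b"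
    show "((\<lambda>s. (f x s)\<^sup>2) has_real_derivative 2 * (f x s * f' x s)) (at s within ball t e)"
      by (rule derivative_eq_intros has_field_derivative_at_within[OF deriv] refl)+
        (use s x e(2) in auto)
  next
    fix s assume s: "s \<in> ball t e"
    have "continuous_on {a..b} (\<lambda>x. f x s)"
      by (rule continuous_on_slice[OF cont(1)]) (use s e(2) in auto)
    then show "(\<lambda>x. (f x s)\<^sup>2) integrable_on cbox a b"
      by (auto intro!: integrable_continuous_real continuous_intros)
  qed (use e(1) cont' in auto)
  then show ?thesis using e(1) by (simp add: at_within_open[of t "ball t e"])
qed

text \<open>Integration by parts: the boundary values of \<open>f * f'\<close> vanish, so the
  integral is minus that of the square of \<open>f'\<close>.\<close>

lemma integral_mult_second_derivative_nonpos:
  fixes f f' f'' :: "real \<Rightarrow> real"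
  assumes "a \<le> b" "f a = 0" "f b = 0"
    and f': "\<And>x. x \<in> {a..b} \<Longrightarrow> (f has_real_derivative f' x) (at x within {a..b})"
    and f'': "\<And>x. x \<in> {a..b} \<Longrightarrow> (f' has_real_derivative f'' x) (at x within {a..b})"
    and cont: "continuous_on {a..b} f''"
  shows "integral {a..b} (\<lambda>x. f x * f'' x) \<le> 0"
proof -
  have cont_f: "continuous_on {a..b} f" "continuous_on {a..b} f'"
    using f' f'' DERIV_continuous_on by blast+
  have "((\<lambda>x. (f' x)\<^sup>2 + f x * f'' x) has_integral f b * f' b - f a * f' a) {a..b}"
  proof (rule fundamental_theorem_of_calculus[OF assms(1)])
    fix x assume "x \<in> {a..b}"
    then show "((\<lambda>x. f x * f' x) has_vector_derivative (f' x)\<^sup>2 + f x * f'' x) (at x within {a..b})"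
      unfolding has_real_derivative_iff_has_vector_derivative[symmetric]
      by (auto intro!: derivative_eq_intros f' f'' simp: power2_eq_square)
  qed
  then have "integral {a..b} (\<lambda>x. (f' x)\<^sup>2 + f x * f'' x) = 0"
    using assms by (simp add: integral_unique)
  moreover have "integral {a..b} (\<lambda>x. (f' x)\<^sup>2 + f x * f'' x)
    = integral {a..b} (\<lambda>x. (f' x)\<^sup>2) + integral {a..b} (\<lambda>x. f x * f'' x)"
    by (intro integral_add integrable_continuous_real continuous_intros cont cont_f)
  moreover have "0 \<le> integral {a..b} (\<lambda>x. (f' x)\<^sup>2)"
    by (intro integral_nonneg integrable_continuous_real continuous_intros cont_f) auto
  ultimately show ?thesis by linarith
qed

section \<open>Energy estimates for the disagreement at a fixed time\<close>

text \<open>Time is frozen: \<open>pt\<close> stands for the time derivative, and \<open>g\<close>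
  for the controller weights at that instant. Diffusion contributes a nonpositive amount for every
  pair, while the controller is evaluated exactly.\<close>

lemma disagreement_dissipation:
  fixes p p' p'' pt :: "'n::finite \<Rightarrow> real \<Rightarrow> real" and g :: "'n \<Rightarrow> 'n \<Rightarrow> real"
  assumes "a \<le> b" "0 \<le> k"
    and bc: "\<And>i. p i a = 0" "\<And>i. p i b = 0"
    and p': "\<And>i x. x \<in> {a..b} \<Longrightarrow> (p i has_real_derivative p' i x) (at x within {a..b})"
    and p'': "\<And>i x. x \<in> {a..b} \<Longrightarrow> (p' i has_real_derivative p'' i x) (at x within {a..b})"
    and cont: "\<And>i. continuous_on {a..b} (p'' i)"
    and g: "\<And>i j. g i j = g j i"
    and pt: "\<And>i x. x \<in> {a..b} \<Longrightarrow>
      pt i x = k * p'' i x - (\<Sum>j\<in>UNIV. g i j * (p i x - p j x))"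
  shows "(\<Sum>i\<in>UNIV. \<Sum>j\<in>UNIV. integral {a..b} (\<lambda>x. 2 * ((p i x - p j x) * (pt i x - pt j x))))
    \<le> - 2 * real CARD('n) * (\<Sum>i\<in>UNIV. \<Sum>j\<in>UNIV. g i j * integral {a..b} (\<lambda>x. (p i x - p j x)\<^sup>2))"
proof -
  have cont_p [continuous_intros]: "continuous_on {a..b} (p i)" for i
    using p' DERIV_continuous_on by blast
  note cont [continuous_intros]
  define u where "u i x = - (\<Sum>j\<in>UNIV. g i j * (p i x - p j x))" for i x
  have cont_u [continuous_intros]: "continuous_on {a..b} (u i)" for i
    unfolding u_def by (intro continuous_intros)
  have pair: "integral {a..b} (\<lambda>x. 2 * ((p i x - p j x) * (pt i x - pt j x)))
    \<le> 2 * integral {a..b} (\<lambda>x. (p i x - p j x) * (u i x - u j x))" for i j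
  proof -
    have "integral {a..b} (\<lambda>x. 2 * ((p i x - p j x) * (pt i x - pt j x)))
      = integral {a..b} (\<lambda>x. 2 * k * ((p i x - p j x) * (p'' i x - p'' j x))
          + 2 * ((p i x - p j x) * (u i x - u j x)))"
      by (rule integral_cong) (simp add: pt u_def algebra_simps)
    also have "\<dots> = integral {a..b} (\<lambda>x. 2 * k * ((p i x - p j x) * (p'' i x - p'' j x)))
      + integral {a..b} (\<lambda>x. 2 * ((p i x - p j x) * (u i x - u j x)))"
      by (intro integral_add integrable_continuous_real continuous_intros)
    also have "\<dots> = 2 * k * integral {a..b} (\<lambda>x. (p i x - p j x) * (p'' i x - p'' j x))
      + 2 * integral {a..b} (\<lambda>x. (p i x - p j x) * (u i x - u j x))"
      by simp
    finally have split: "integral {a..b} (\<lambda>x. 2 * ((p i x - p j x) * (pt i x - pt j x)))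
      = 2 * k * integral {a..b} (\<lambda>x. (p i x - p j x) * (p'' i x - p'' j x))
        + 2 * integral {a..b} (\<lambda>x. (p i x - p j x) * (u i x - u j x))" .
    have "integral {a..b} (\<lambda>x. (p i x - p j x) * (p'' i x - p'' j x)) \<le> 0"
      by (rule integral_mult_second_derivative_nonpos[OF assms(1), where f' = "\<lambda>x. p' i x - p' j x"])
        (auto intro!: derivative_intros p' p'' continuous_intros simp: bc)
    then have "2 * k * integral {a..b} (\<lambda>x. (p i x - p j x) * (p'' i x - p'' j x)) \<le> 0"
      using assms(2) by (simp only: mult_nonneg_nonpos mult_nonneg_nonneg zero_le_numeral)
    then show ?thesis unfolding split by simp
  qed
  \<comment> \<open>As the \<open>u i x\<close> sum to zero, the pair sum is
    \<open>2 * real CARD('n)\<close> times the sum of \<open>p i x * u i x\<close>, and symmetrising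
    the latter gives minus half the weighted squares.\<close>
  have pointwise: "(\<Sum>i\<in>UNIV. \<Sum>j\<in>UNIV. (p i x - p j x) * (u i x - u j x))
    = - real CARD('n) * (\<Sum>i\<in>UNIV. \<Sum>j\<in>UNIV. g i j * (p i x - p j x)\<^sup>2)" for x
    using sum_symmetric_weights[of g "\<lambda>i. p i x", OF g]
      sum_symmetric_weights_eq_0[of g "\<lambda>i. p i x", OF g]
      sum_pairs_mult_diff[of "\<lambda>i. p i x" "\<lambda>i. u i x"]
    by (simp add: u_def sum_negf)
  have "(\<Sum>i\<in>UNIV. \<Sum>j\<in>UNIV. integral {a..b} (\<lambda>x. 2 * ((p i x - p j x) * (pt i x - pt j x))))
    \<le> (\<Sum>i\<in>UNIV. \<Sum>j\<in>UNIV. 2 * integral {a..b} (\<lambda>x. (p i x - p j x) * (u i x - u j x)))"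
    by (intro sum_mono pair)
  also have "\<dots> = 2 * integral {a..b} (\<lambda>x. \<Sum>i\<in>UNIV. \<Sum>j\<in>UNIV. (p i x - p j x) * (u i x - u j x))"
    by (simp add: integral_sum integrable_continuous_real continuous_intros sum_distrib_left)
  also have "\<dots> = - 2 * real CARD('n)
      * integral {a..b} (\<lambda>x. \<Sum>i\<in>UNIV. \<Sum>j\<in>UNIV. g i j * (p i x - p j x)\<^sup>2)"
    by (simp add: pointwise)
  also have "\<dots> = - 2 * real CARD('n)
      * (\<Sum>i\<in>UNIV. \<Sum>j\<in>UNIV. g i j * integral {a..b} (\<lambda>x. (p i x - p j x)\<^sup>2))"
    by (simp add: integral_sum integrable_continuous_real continuous_intros)
  finally show ?thesis .
qed

lemma integral_disagreement:
  fixes p :: "'n::finite \<Rightarrow> real \<Rightarrow> real"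
  assumes "\<And>i. continuous_on {a..b} (p i)"
  shows "integral {a..b} (\<lambda>x. c * (\<Sum>i\<in>UNIV. \<Sum>j\<in>UNIV. m i j * (p i x - p j x)\<^sup>2))
    = c * (\<Sum>i\<in>UNIV. \<Sum>j\<in>UNIV. m i j * integral {a..b} (\<lambda>x. (p i x - p j x)\<^sup>2))"
  by (simp add: integral_sum integrable_continuous_real continuous_intros assms)

text \<open>The spectral bound for \<open>B\<close> holds at every \<open>x\<close> and is
  integrated over space. Subadditivity of the power \<open>\<alpha>\<close> is then used twice, once
  for each of the nested sums.\<close>

lemma disagreement_decay_rate:
  fixes A :: "real^'n::finite^'n" and p :: "'n \<Rightarrow> real \<Rightarrow> real" and a b \<alpha> :: real
  defines "w \<equiv> \<lambda>i j. integral {a..b} (\<lambda>x. (p i x - p j x)\<^sup>2)"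
    and "B \<equiv> (\<chi> i j. (A $ i $ j) powr (1 / \<alpha>)) :: real^'n^'n"
  assumes "2 \<le> CARD('n)" "nonneg_matrix A" "undirected A" "0 < \<alpha>" "\<alpha> < 1"
    and lam: "0 \<le> lambda2 (laplacian B)"
    and cont: "\<And>i. continuous_on {a..b} (p i)"
  shows "(2 * lambda2 (laplacian B)) powr \<alpha>
      * (1 / (2 * real CARD('n)) * (\<Sum>i\<in>UNIV. \<Sum>j\<in>UNIV. w i j)) powr \<alpha>
    \<le> (\<Sum>i\<in>UNIV. \<Sum>j\<in>UNIV. A $ i $ j * w i j powr \<alpha>)"
proof -
  have w: "0 \<le> w i j" for i j
    unfolding w_def by (intro integral_nonneg integrable_continuous_real continuous_intros cont) auto
  have A: "0 \<le> A $ i $ j" for i j using assms(4) by (simp add: nonneg_matrix_def)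
  have B: "undirected B" using assms(5) by (simp add: undirected_def B_def)
  let ?S = "1 / (2 * real CARD('n)) * (\<Sum>i\<in>UNIV. \<Sum>j\<in>UNIV. w i j)"
  have S: "0 \<le> ?S" by (simp add: sum_nonneg w)
  have "2 * lambda2 (laplacian B) * ?S
    = integral {a..b} (\<lambda>x. 2 * lambda2 (laplacian B)
        * (1 / (2 * real CARD('n)) * (\<Sum>i\<in>UNIV. \<Sum>j\<in>UNIV. (p i x - p j x)\<^sup>2)))"
    using integral_disagreement[of a b p, OF cont, of "2 * lambda2 (laplacian B) * (1 / (2 * real CARD('n)))" "\<lambda>_ _. 1", symmetric]
    by (simp add: w_def)
  also have "\<dots> \<le> integral {a..b} (\<lambda>x. \<Sum>i\<in>UNIV. \<Sum>j\<in>UNIV. B $ i $ j * (p i x - p j x)\<^sup>2)"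
    by (intro integral_le integrable_continuous_real continuous_intros cont
        lambda2_laplacian_le[OF assms(3) B])
  also have "\<dots> = (\<Sum>i\<in>UNIV. \<Sum>j\<in>UNIV. B $ i $ j * w i j)"
    using integral_disagreement[of a b p, OF cont, of 1] by (simp add: w_def)
  finally have "(2 * lambda2 (laplacian B) * ?S) powr \<alpha>
    \<le> (\<Sum>i\<in>UNIV. \<Sum>j\<in>UNIV. B $ i $ j * w i j) powr \<alpha>"
    by (intro powr_mono2 mult_nonneg_nonneg S) (use lam assms(6) in auto)
  also have "\<dots> \<le> (\<Sum>i\<in>UNIV. (\<Sum>j\<in>UNIV. B $ i $ j * w i j) powr \<alpha>)"
    using assms(6,7) by (intro sum_powr_le sum_nonneg) (auto simp: B_def w)
  also have "\<dots> \<le> (\<Sum>i\<in>UNIV. \<Sum>j\<in>UNIV. (B $ i $ j * w i j) powr \<alpha>)"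
    using assms(6,7) by (intro sum_powr_le sum_mono) (auto simp: B_def w)
  \<comment> \<open>The exponent \<open>1 / \<alpha>\<close> in \<open>B\<close> is chosen so that
    the power \<open>\<alpha>\<close> gives back the entries of \<open>A\<close>.\<close>
  also have "\<dots> = (\<Sum>i\<in>UNIV. \<Sum>j\<in>UNIV. A $ i $ j * w i j powr \<alpha>)"
    using assms(6) by (simp add: B_def powr_mult powr_powr A w)
  finally show ?thesis using lam S by (subst powr_mult[symmetric]) auto
qed

section \<open>Extinction of the disagreement along a solution\<close>

theorem corollary3p1:
  fixes A B :: "real^'n^'n" and \<alpha> L k C1 :: real
    and y0 :: "'n::finite \<Rightarrow> real \<Rightarrow> real"
    and y :: "'n \<Rightarrow> real \<Rightarrow> real \<Rightarrow> real"
  assumes "0 < \<alpha>" and "\<alpha> < 1" and "0 < L" and "0 < k"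
    and "nonneg_matrix A" and "undirected A" and "connected_graph A"
    and "\<And>i. continuous_on {0..L} (y0 i)" and "\<And>i. bounded (y0 i ` {0..L})"
    and "heat_solution k L (controller A \<alpha> L y) y0 y"
    and B_def: "B = (\<chi> i j. (A $ i $ j) powr (1 / \<alpha>))"
    and C1_def: "C1 = (2 * lambda2 (laplacian B)) powr \<alpha>"
  shows "achieves_FTC L y \<and>
    (\<exists>ts. terminal_time L y ts \<and>
       ts \<le> (integral {0..L}
               (\<lambda>x. 1 / (2 * real CARD('n)) * (\<Sum>i\<in>UNIV. \<Sum>j\<in>UNIV. (y0 i x - y0 j x)\<^sup>2))) powr (1 - \<alpha>)
             / (C1 * (1 - \<alpha>)))"
proof -
  define w where "w i j t = integral {0..L} (\<lambda>x. (xi y i j x t)\<^sup>2)" for i j t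
  define V where "V t = 1 / (2 * real CARD('n)) * (\<Sum>i\<in>UNIV. \<Sum>j\<in>UNIV. w i j t)" for t
  \<comment> \<open>With these symmetric, time-dependent weights the controller is formally a linear
    consensus protocol.\<close>
  define g where "g t i j = A $ i $ j * w i j t powr (\<alpha> - 1)" for t i j
  define ts where "ts = V 0 powr (1 - \<alpha>) / (C1 * (1 - \<alpha>))"
  have sym: "A $ i $ j = A $ j $ i" for i j using assms(6) by (simp add: undirected_def)
  have B: "nonneg_matrix B" "undirected B" "connected_graph B"
  proof -
    show "nonneg_matrix B" "undirected B"
      using sym by (simp_all add: B_def nonneg_matrix_def undirected_def)
    have "0 < B $ i $ j \<longleftrightarrow> 0 < A $ i $ j" for i j
      using assms(5) by (auto simp: B_def nonneg_matrix_def order_less_le)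
    then show "connected_graph B" using assms(7) by (simp add: connected_graph_def)
  qed

  note sol = assms(10)[unfolded heat_solution_def]
  have cont: "continuous_on ({0..L} \<times> {0..} - {(0,0), (L,0)}) (\<lambda>(x, t). y i x t)"
    and bdd: "bounded ((\<lambda>(x, t). y i x t) ` ({0..L} \<times> {0..T}))"
    and init: "x \<in> {0..L} \<Longrightarrow> y i x 0 = y0 i x"
    and bc: "0 < t \<Longrightarrow> y i 0 t = 0" "0 < t \<Longrightarrow> y i L t = 0" for i x t T
    using sol by auto
  obtain E yt yx yxx where E: "finite E"
    and cont_t: "\<And>i. continuous_on ({0..L} \<times> ({0<..} - E)) (\<lambda>(x, t). yt i x t)"
    and cont_xx: "\<And>i. continuous_on ({0..L} \<times> ({0<..} - E)) (\<lambda>(x, t). yxx i x t)"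
    and eqs: "\<forall>i. \<forall>x\<in>{0..L}. \<forall>t\<in>{0<..} - E.
        ((\<lambda>s. y i x s) has_real_derivative yt i x t) (at t) \<and>
        ((\<lambda>z. y i z t) has_real_derivative yx i x t) (at x within {0..L}) \<and>
        ((\<lambda>z. yx i z t) has_real_derivative yxx i x t) (at x within {0..L}) \<and>
        yt i x t = k * yxx i x t + controller A \<alpha> L y i x t"
    using sol by blast
  have D: "((\<lambda>s. y i x s) has_real_derivative yt i x t) (at t)"
    "((\<lambda>z. y i z t) has_real_derivative yx i x t) (at x within {0..L})"
    "((\<lambda>z. yx i z t) has_real_derivative yxx i x t) (at x within {0..L})"
    "yt i x t = k * yxx i x t + controller A \<alpha> L y i x t"
    if "x \<in> {0..L}" "t \<in> {0<..} - E" for i x t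
    using eqs that by blast+

  \<comment> \<open>At time 0 the slice passes through the corners, so continuity is taken from the
    initial data.\<close>
  have cont_x: "continuous_on {0..L} (\<lambda>x. y i x t)" if "0 \<le> t" for i t
  proof (cases "t = 0")
    case True
    then show ?thesis using assms(8)[of i] init continuous_on_cong by metis
  next
    case False
    then show ?thesis using that by (intro continuous_on_slice[OF cont]) auto
  qed
  \<comment> \<open>At an endpoint of the space interval, time 0 has to be left out because it
    belongs to a corner.\<close>
  have cont_time: "continuous_on T (y i x)"
    if "x \<in> {0..L}" "T \<subseteq> {0..}" "x \<in> {0<..<L} \<or> 0 \<notin> T" for i x T
  proof -
    have "(\<lambda>t. (x, t)) ` T \<subseteq> {0..L} \<times> {0..} - {(0,0), (L,0)}"
      using that by auto
    from continuous_on_compose2[OF cont _ this] show ?thesis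
      by (simp add: continuous_on_Pair continuous_on_const continuous_on_id)
  qed

  have w_nonneg: "0 \<le> w i j t" if "0 \<le> t" for i j t
    unfolding w_def xi_def
    by (intro integral_nonneg integrable_continuous_real continuous_intros cont_x that) auto
  have V_nonneg: "0 \<le> V t" if "0 \<le> t" for t
    unfolding V_def by (simp add: sum_nonneg w_nonneg that)

  \<comment> \<open>Continuity has to reach time 0 and the times in \<open>E\<close>. It follows by
    dominated convergence, with the bound on \<open>y\<close> controlling the corners.\<close>
  have cont_w: "continuous_on {0..T} (w i j)" for i j T
  proof -
    obtain b where b: "\<And>x t. x \<in> {0..L} \<Longrightarrow> t \<in> {0..T} \<Longrightarrow> \<bar>y i x t\<bar> \<le> b"
      using bdd[of i T] by (force simp: bounded_iff)
    obtain c where c: "\<And>x t. x \<in> {0..L} \<Longrightarrow> t \<in> {0..T} \<Longrightarrow> \<bar>y j x t\<bar> \<le> c"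
      using bdd[of j T] by (force simp: bounded_iff)
    have "\<bar>(y i x t - y j x t)\<^sup>2\<bar> \<le> (b + c)\<^sup>2" if "x \<in> {0..L}" "t \<in> {0..T}" for x t
    proof -
      have "\<bar>y i x t - y j x t\<bar> \<le> b + c" using b[OF that] c[OF that] by linarith
      then show ?thesis by (simp add: power2_le_iff_abs_le order_trans[OF abs_ge_zero])
    qed
    then show ?thesis
      unfolding w_def xi_def
      by (intro continuous_on_integral_of_bounded)
        (auto intro!: continuous_intros cont_time integrable_continuous_real cont_x)
  qed
  have cont_V: "continuous_on {0..T} V" for T
    unfolding V_def by (intro continuous_intros cont_w)

  have deriv_w: "(w i j has_real_derivative
      integral {0..L} (\<lambda>x. 2 * ((y i x t - y j x t) * (yt i x t - yt j x t)))) (at t)"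
    if t: "t \<in> {0<..} - E" for i j t
    unfolding w_def xi_def
  proof (rule has_real_derivative_integral_square[OF _ t])
    show "open ({0<..} - E)" using E by (simp add: open_Diff finite_imp_closed)
    show "continuous_on ({0..L} \<times> ({0<..} - E)) (\<lambda>(x, s). y i x s - y j x s)"
      unfolding case_prod_unfold
      by (intro continuous_on_diff; rule continuous_on_subset[OF cont[unfolded case_prod_unfold]]) auto
    show "continuous_on ({0..L} \<times> ({0<..} - E)) (\<lambda>(x, s). yt i x s - yt j x s)"
      unfolding case_prod_unfold
      by (intro continuous_on_diff cont_t[unfolded case_prod_unfold])
  qed (auto intro!: derivative_intros D)

  define V' where "V' t = 1 / (2 * real CARD('n)) * (\<Sum>i\<in>UNIV. \<Sum>j\<in>UNIV.
      integral {0..L} (\<lambda>x. 2 * ((y i x t - y j x t) * (yt i x t - yt j x t))))" for t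
  have deriv_V: "(V has_real_derivative V' t) (at t)" if "t \<in> {0<..} - E" for t
    unfolding V_def V'_def by (intro DERIV_cmult DERIV_sum deriv_w that)

  have dissipation: "V' t \<le> - (\<Sum>i\<in>UNIV. \<Sum>j\<in>UNIV. A $ i $ j * w i j t powr \<alpha>)"
    if t: "t \<in> {0<..} - E" for t
  proof -
    have w_sym: "w i j t = w j i t" for i j by (simp add: w_def xi_def power2_commute)
    have "(\<Sum>i\<in>UNIV. \<Sum>j\<in>UNIV.
        integral {0..L} (\<lambda>x. 2 * ((y i x t - y j x t) * (yt i x t - yt j x t))))
      \<le> - 2 * real CARD('n) * (\<Sum>i\<in>UNIV. \<Sum>j\<in>UNIV.
          g t i j * integral {0..L} (\<lambda>x. (y i x t - y j x t)\<^sup>2))"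
    proof (rule disagreement_dissipation[where k = k and p' = "\<lambda>i x. yx i x t" and p'' = "\<lambda>i x. yxx i x t"])
      show "continuous_on {0..L} (\<lambda>x. yxx i x t)" for i
        using t by (intro continuous_on_slice[OF cont_xx]) auto
      show "g t i j = g t j i" for i j by (simp add: g_def sym[of i j] w_sym[of i j])
      show "yt i x t = k * yxx i x t - (\<Sum>j\<in>UNIV. g t i j * (y i x t - y j x t))"
        if "x \<in> {0..L}" for i x
        using D(4)[OF that t] by (simp add: controller_def g_def w_def xi_def)
    qed (use assms(3,4) t bc D(2,3) in auto)
    also have "\<dots> = - 2 * real CARD('n) * (\<Sum>i\<in>UNIV. \<Sum>j\<in>UNIV. A $ i $ j * w i j t powr \<alpha>)"
    proof -
      \<comment> \<open>If \<open>w i j t = 0\<close>, both sides are 0 because \<open>powr\<close>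
        with base 0 is 0, so the singular weight does no harm.\<close>
      have "w i j t powr (\<alpha> - 1) * w i j t = w i j t powr \<alpha>" for i j
        using w_nonneg[of t i j] t by (cases "w i j t = 0") (auto simp: powr_mult_base mult.commute)
      then have "g t i j * integral {0..L} (\<lambda>x. (y i x t - y j x t)\<^sup>2) = A $ i $ j * w i j t powr \<alpha>"
        for i j by (simp add: g_def mult.assoc flip: xi_def w_def)
      then show ?thesis by simp
    qed
    finally show ?thesis
      unfolding V'_def by (simp add: field_simps)
  qed

  have consensus: "y i x t = y j x t" if t: "ts \<le> t" "0 \<le> t" and x: "x \<in> {0..L}" for i j x t
  proof (cases "2 \<le> CARD('n)")
    \<comment> \<open>for a single agent \<open>lambda2\<close> is a junk value, and there is nothing to prove\<close>
    case False
    then have "i = j" using card_le_Suc0_iff_eq[of "UNIV :: 'n set"] by auto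
    then show ?thesis by simp
  next
    case True
    have lam: "0 < lambda2 (laplacian B)" by (rule lambda2_laplacian_pos[OF True B])
    then have C1: "0 < C1" by (simp add: C1_def)
    have "V t = 0"
    proof (rule finite_time_extinction[OF E cont_V V_nonneg deriv_V])
      fix s assume s: "s \<in> {0<..} - E"
      have "C1 * V s powr \<alpha> \<le> (\<Sum>i\<in>UNIV. \<Sum>j\<in>UNIV. A $ i $ j * w i j s powr \<alpha>)"
        unfolding C1_def B_def V_def w_def xi_def
        by (rule disagreement_decay_rate[OF True])
          (use assms(1,2,5,6) lam s cont_x in \<open>auto simp: B_def\<close>)
      then show "V' s \<le> - C1 * V s powr \<alpha>" using dissipation[OF s] by simp
    next
      show "V 0 powr (1 - \<alpha>) \<le> C1 * (1 - \<alpha>) * t"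
        using t(1) C1 assms(2) by (simp add: ts_def field_simps)
    qed (use C1 assms(2) t in auto)
    then have "w i j t = 0"
      using w_nonneg[OF t(2)] by (simp add: V_def sum_nonneg_eq_0_iff sum_nonneg)
    \<comment> \<open>A continuous nonnegative function with integral zero vanishes everywhere on
      the interval, which upgrades agreement in mean square to agreement at every point.\<close>
    then have "\<forall>x\<in>{0..L}. (xi y i j x t)\<^sup>2 = 0"
      unfolding w_def using assms(3)
      by (subst (asm) integral_eq_0_iff) (auto simp: xi_def intro!: continuous_intros cont_x t(2))
    then show ?thesis using x by (simp add: xi_def)
  qed

  \<comment> \<open>As a value of \<open>powr\<close>, \<open>C1\<close> is nonnegative whatever
    \<open>lambda2\<close> is, so a single agent is covered too.\<close>
  have ts: "0 \<le> ts" using assms(2) by (simp add: ts_def C1_def)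
  have "terminal_time L y ts"
    unfolding terminal_time_def
  proof (intro conjI ts ballI allI)
    fix x i j assume x: "x \<in> {0..L}"
    show "((\<lambda>t. \<bar>y i x t - y j x t\<bar>) \<longlongrightarrow> 0) (at ts within {0..})"
    proof (cases "ts = 0")
      \<comment> \<open>The solution may jump at a corner at time 0, but the difference is
        identically zero at all times from 0 on, so no continuity is invoked.\<close>
      case True
      then have "\<forall>\<^sub>F t in at ts within {0..}. \<bar>y i x t - y j x t\<bar> = 0"
        using consensus[OF _ _ x] by (auto simp: eventually_at_filter)
      then show ?thesis by (rule tendsto_eventually)
    next
      case False
      then have "0 < ts" using ts by simp
      \<comment> \<open>At a positive time the solution is continuous in time even at the ends of
        the space interval, so the limit is the value at \<open>ts\<close>, which is zero.\<close>
      then have "isCont (\<lambda>t. \<bar>y i x t - y j x t\<bar>) ts"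
        using x by (intro continuous_on_interior[of "{0<..}"] continuous_intros cont_time)
          (auto simp: interior_open)
      then have "((\<lambda>t. \<bar>y i x t - y j x t\<bar>) \<longlongrightarrow> \<bar>y i x ts - y j x ts\<bar>) (at ts within {0..})"
        using isCont_def tendsto_within_subset by blast
      then show ?thesis using consensus[OF order_refl ts x, of i j] by simp
    qed
  qed
  moreover have "V 0 = integral {0..L}
      (\<lambda>x. 1 / (2 * real CARD('n)) * (\<Sum>i\<in>UNIV. \<Sum>j\<in>UNIV. (y0 i x - y0 j x)\<^sup>2))"
  proof -
    have "w i j 0 = integral {0..L} (\<lambda>x. (y0 i x - y0 j x)\<^sup>2)" for i j
      unfolding w_def xi_def by (rule integral_cong) (simp add: init)
    then show ?thesis
      using integral_disagreement[of 0 L y0, OF assms(8), of "1 / (2 * real CARD('n))" "\<lambda>_ _. 1", symmetric]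
      by (simp add: V_def)
  qed
  ultimately show ?thesis
    unfolding achieves_FTC_def ts_def by auto
qed

end
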